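(* Let $N\in\mathbb{N}$, let $u(t),y(t)\in\mathbb{R}$ for $t\le N$ be the input and output data, and let $\gamma_b=\frac{\sigma^2}{N\lambda_b}$, $\gamma_c=\frac{\sigma^2}{N\lambda_c}$ with $\sigma^2,\lambda_b,\lambda_c>0$. Let $\mathcal{H}_b,\mathcal{H}_c\subseteq\ell^2$ be the reproducing kernel Hilbert spaces (of real sequences indexed by $k=1,2,\dots$) with kernels $\mathcal{K}_b,\mathcal{K}_c\in\mathbb{R}^{\infty\times\infty}$ and norms $\|\cdot\|_{\mathcal{H}_b},\|\cdot\|_{\mathcal{H}_c}$. Assume that (1) $\mathcal{K}_b$ and $\mathcal{K}_c$ are stable, i.e. $\mathcal{H}_b\subset\ell^1$ and $\mathcal{H}_c\subset\ell^1$; (2) there exists $M\in\mathbb{N}$ such that $y(s)=u(s)=0$ for all $s<-M$. Then the Tikhonov regularization problem $$\min_{\vartheta=(b,c)\in\mathcal{H}_b\times\mathcal{H}_c} V_N(\vartheta)+\gamma_b\|b\|_{\mathcal{H}_b}^2+\gamma_c\|c\|_{\mathcal{H}_c}^2$$ admits a solution, i.e. the minimum is attained at some $\vartheta\in\mathcal{H}_b\times\mathcal{H}_c$.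
   Context: $\ell^1$ and $\ell^2$ are the spaces of absolutely summable and square summable real sequences indexed by $k=1,2,\dots$. For $\vartheta=(b,c)$ with $b=(b_k)_{k\ge1}$, $c=(c_k)_{k\ge1}$, put $B(z)=\sum_{k=1}^\infty b_kz^{-k}$ and $C(z)=1+\sum_{k=1}^\infty c_kz^{-k}$, where $z^{-1}$ acts as the backward shift on signals. The prediction error is $$\varepsilon_\vartheta(t)=\frac{1}{C(z)}\,[\,y(t)-B(z)u(t)\,],$$ and the average squared prediction error is $V_N(\vartheta)=\frac1N\sum_{t=1}^N\varepsilon_\vartheta(t)^2$. Explicitly, $1/C(z)=\sum_{k\ge0}h_kz^{-k}$ is the formal power series inverse of $C(z)$ in $z^{-1}$, with $h_0=1$ and $h_k=-c_k-\sum_{i=1}^{k-1}c_ih_{k-i}$ for $k\ge1$. When $y(s)=u(s)=0$ for all $s<-M$, $$\varepsilon_\vartheta(t)=\sum_{k=0}^{t+M}h_k\,y(t-k)-\sum_{k=0}^{t+M}\sum_{l=1}^{t-k+M}h_kb_l\,u(t-k-l),\qquad t=1,\dots,N,$$ which is a finite sum. *)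

theory Defs
  imports "HOL-Analysis.Analysis" "HOL-Computational_Algebra.Formal_Power_Series"
begin

text \<open>
  A real sequence indexed by \<open>k = 1, 2, \<dots>\<close> is represented by a function
  \<open>x :: nat \<Rightarrow> real\<close> with \<open>x 0 = 0\<close>; more generally, a real function on a set \<open>X\<close> is represented
  by its extension by zero to the whole type.
\<close>

definition ell1 :: "(nat \<Rightarrow> real) set" where
  "ell1 = {x. x 0 = 0 \<and> summable (\<lambda>k. \<bar>x k\<bar>)}"

definition ell2 :: "(nat \<Rightarrow> real) set" where
  "ell2 = {x. x 0 = 0 \<and> summable (\<lambda>k. (x k)\<^sup>2)}"

definition ip_norm :: "(('a \<Rightarrow> real) \<Rightarrow> ('a \<Rightarrow> real) \<Rightarrow> real) \<Rightarrow> ('a \<Rightarrow> real) \<Rightarrow> real" where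
  "ip_norm ip f = sqrt (ip f f)"

definition kernel_section :: "'a set \<Rightarrow> ('a \<Rightarrow> 'a \<Rightarrow> real) \<Rightarrow> 'a \<Rightarrow> 'a \<Rightarrow> real" where
  "kernel_section X K a = (\<lambda>x. if x \<in> X then K x a else 0)"

text \<open>
  \<open>rkhs X K H ip\<close>: the set \<open>H\<close> of real functions on \<open>X\<close>, with inner product \<open>ip\<close>, is the
  reproducing kernel Hilbert space with kernel \<open>K\<close> on \<open>X\<close>.  Symmetry and positive
  semidefiniteness of \<open>K\<close> are consequences, see below.
\<close>

locale rkhs =
  fixes X :: "'a set"
    and K :: "'a \<Rightarrow> 'a \<Rightarrow> real"
    and H :: "('a \<Rightarrow> real) set"
    and ip :: "('a \<Rightarrow> real) \<Rightarrow> ('a \<Rightarrow> real) \<Rightarrow> real"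
  assumes supported: "f \<in> H \<Longrightarrow> x \<notin> X \<Longrightarrow> f x = 0"
    and zero_mem: "(\<lambda>x. 0) \<in> H"
    and add_mem: "f \<in> H \<Longrightarrow> g \<in> H \<Longrightarrow> (\<lambda>x. f x + g x) \<in> H"
    and scale_mem: "f \<in> H \<Longrightarrow> (\<lambda>x. r * f x) \<in> H"
    and ip_commute: "f \<in> H \<Longrightarrow> g \<in> H \<Longrightarrow> ip f g = ip g f"
    and ip_add_left:
      "f \<in> H \<Longrightarrow> g \<in> H \<Longrightarrow> h \<in> H \<Longrightarrow> ip (\<lambda>x. f x + g x) h = ip f h + ip g h"
    and ip_scale_left: "f \<in> H \<Longrightarrow> g \<in> H \<Longrightarrow> ip (\<lambda>x. r * f x) g = r * ip f g"
    and ip_nonneg: "f \<in> H \<Longrightarrow> 0 \<le> ip f f"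
    and ip_definite: "f \<in> H \<Longrightarrow> ip f f = 0 \<Longrightarrow> f = (\<lambda>x. 0)"
    and complete:
      "(\<And>n. F n \<in> H) \<Longrightarrow>
       (\<forall>e>0. \<exists>n0. \<forall>m\<ge>n0. \<forall>n\<ge>n0. ip_norm ip (\<lambda>x. F m x - F n x) < e) \<Longrightarrow>
       \<exists>f\<in>H. (\<lambda>n. ip_norm ip (\<lambda>x. F n x - f x)) \<longlonglongrightarrow> 0"
    and kernel_section_mem: "a \<in> X \<Longrightarrow> kernel_section X K a \<in> H"
    and reproducing: "f \<in> H \<Longrightarrow> a \<in> X \<Longrightarrow> ip f (kernel_section X K a) = f a"
begin

lemma kernel_sym:
  assumes "a \<in> X" "b \<in> X"
  shows "K a b = K b a"
proof -
  have "K a b = ip (kernel_section X K b) (kernel_section X K a)"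
    using assms by (simp add: reproducing kernel_section_mem) (simp add: kernel_section_def)
  also have "\<dots> = ip (kernel_section X K a) (kernel_section X K b)"
    using assms by (intro ip_commute kernel_section_mem)
  also have "\<dots> = K b a"
    using assms by (simp add: reproducing kernel_section_mem) (simp add: kernel_section_def)
  finally show ?thesis .
qed

lemma ip_sum_left:
  assumes "finite A" "\<And>a. a \<in> A \<Longrightarrow> G a \<in> H" "g \<in> H"
  shows "(\<lambda>x. \<Sum>a\<in>A. w a * G a x) \<in> H \<and>
    ip (\<lambda>x. \<Sum>a\<in>A. w a * G a x) g = (\<Sum>a\<in>A. w a * ip (G a) g)"
  using assms
proof (induction A rule: finite_induct)
  case empty
  have "ip (\<lambda>x. 0 * (\<lambda>x. 0) x) g = 0 * ip (\<lambda>x. 0) g"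
    using empty.prems zero_mem by (intro ip_scale_left)
  then show ?case using zero_mem by simp
next
  case (insert a A)
  then show ?case
    by (simp add: add_mem scale_mem ip_add_left ip_scale_left)
qed

lemma kernel_psd:
  assumes "finite A" "A \<subseteq> X"
  shows "0 \<le> (\<Sum>a\<in>A. \<Sum>b\<in>A. w a * w b * K a b)"
proof -
  define f where "f = (\<lambda>x. \<Sum>a\<in>A. w a * kernel_section X K a x)"
  have mem: "kernel_section X K a \<in> H" if "a \<in> A" for a
    using that assms kernel_section_mem by blast
  have fH: "f \<in> H"
    unfolding f_def using ip_sum_left[of A "kernel_section X K" "\<lambda>x. 0" w] assms(1) mem zero_mem by blast
  have "ip f f = (\<Sum>a\<in>A. w a * ip (kernel_section X K a) f)"
    using ip_sum_left[of A "kernel_section X K" f w] assms(1) mem fH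
    by (simp add: f_def)
  also have "\<dots> = (\<Sum>a\<in>A. w a * f a)"
  proof (rule sum.cong)
    fix a assume "a \<in> A"
    then show "w a * ip (kernel_section X K a) f = w a * f a"
      using mem[of a] fH assms(2) ip_commute[of "kernel_section X K a" f] reproducing[of f a]
      by auto
  qed simp
  also have "\<dots> = (\<Sum>a\<in>A. \<Sum>b\<in>A. w a * w b * K a b)"
    using assms(2)
    by (auto simp: f_def kernel_section_def sum_distrib_left mult.assoc intro!: sum.cong)
  finally show ?thesis using ip_nonneg[OF fH] by simp
qed

end

text \<open>
  A formal power series \<open>F\<close> in the backward shift \<open>z\<^sup>-\<^sup>1\<close> acts on signals by
  \<open>(F x)(t) = (\<Sum>k. F\<^sub>k x(t - k))\<close>.  For signals vanishing before some time this is a finite sum.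
\<close>

definition shift_filter :: "real fps \<Rightarrow> (int \<Rightarrow> real) \<Rightarrow> int \<Rightarrow> real" where
  "shift_filter F x t = (\<Sum>k. fps_nth F k * x (t - int k))"

definition B_fps :: "(nat \<Rightarrow> real) \<Rightarrow> real fps" where
  "B_fps b = Abs_fps (\<lambda>k. if k = 0 then 0 else b k)"

definition C_fps :: "(nat \<Rightarrow> real) \<Rightarrow> real fps" where
  "C_fps c = Abs_fps (\<lambda>k. if k = 0 then 1 else c k)"

definition pred_error ::
    "(int \<Rightarrow> real) \<Rightarrow> (int \<Rightarrow> real) \<Rightarrow> (nat \<Rightarrow> real) \<Rightarrow> (nat \<Rightarrow> real) \<Rightarrow> int \<Rightarrow> real" where
  "pred_error u y b c =
     shift_filter (inverse (C_fps c)) (\<lambda>t. y t - shift_filter (B_fps b) u t)"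

definition avg_sq_error ::
    "nat \<Rightarrow> (int \<Rightarrow> real) \<Rightarrow> (int \<Rightarrow> real) \<Rightarrow> (nat \<Rightarrow> real) \<Rightarrow> (nat \<Rightarrow> real) \<Rightarrow> real" where
  "avg_sq_error N u y b c = (1 / real N) * (\<Sum>t=1..N. (pred_error u y b c (int t))\<^sup>2)"

lemma inverse_C_fps_nth:
  "fps_nth (inverse (C_fps c)) 0 = 1"
  "k \<ge> 1 \<Longrightarrow> fps_nth (inverse (C_fps c)) k =
     - c k - (\<Sum>i=1..<k. c i * fps_nth (inverse (C_fps c)) (k - i))"
proof -
  let ?h = "fps_nth (inverse (C_fps c))"
  show h0: "?h 0 = 1" by (simp add: C_fps_def)
  assume k: "k \<ge> 1"
  have "C_fps c * inverse (C_fps c) = 1"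
    by (rule inverse_mult_eq_1') (simp add: C_fps_def)
  then have "0 = fps_nth (C_fps c * inverse (C_fps c)) k"
    using k by simp
  also have "\<dots> = (\<Sum>i=0..k. fps_nth (C_fps c) i * ?h (k - i))"
    by (simp add: fps_mult_nth)
  also have "{0..k} = insert 0 (insert k {1..<k})" using k by auto
  also have "(\<Sum>i\<in>\<dots>. fps_nth (C_fps c) i * ?h (k - i)) =
      ?h k + c k + (\<Sum>i=1..<k. fps_nth (C_fps c) i * ?h (k - i))"
    using k h0 by (simp add: C_fps_def)
  also have "(\<Sum>i=1..<k. fps_nth (C_fps c) i * ?h (k - i)) = (\<Sum>i=1..<k. c i * ?h (k - i))"
    by (intro sum.cong) (auto simp: C_fps_def)
  finally show "?h k = - c k - (\<Sum>i=1..<k. c i * ?h (k - i))" by simp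
qed

lemma shift_filter_finite:
  assumes "\<And>k. k > n \<Longrightarrow> x (t - int k) = 0"
  shows "shift_filter F x t = (\<Sum>k=0..n. fps_nth F k * x (t - int k))"
  unfolding shift_filter_def by (rule suminf_finite) (auto simp: assms)

lemma pred_error_explicit:
  fixes M t :: nat and c :: "nat \<Rightarrow> real"
  assumes "\<And>s. s < - int M \<Longrightarrow> y s = 0 \<and> u s = 0"
  defines "h \<equiv> fps_nth (inverse (C_fps c))"
  shows "pred_error u y b c (int t) =
    (\<Sum>k=0..t + M. h k * y (int t - int k)) -
    (\<Sum>k=0..t + M. \<Sum>l=1..t + M - k. h k * b l * u (int t - int k - int l))"
proof -
  have early: "shift_filter (B_fps b) u s = 0" if "s < - int M" for s
    using shift_filter_finite[of 0 u s "B_fps b"] that assms(1) by (simp add: B_fps_def)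
  have late: "shift_filter (B_fps b) u (int t - int k) =
      (\<Sum>l=1..t + M - k. b l * u (int t - int k - int l))" if "k \<le> t + M" for k
  proof -
    have "shift_filter (B_fps b) u (int t - int k) =
        (\<Sum>l=0..t + M - k. fps_nth (B_fps b) l * u (int t - int k - int l))"
      using that assms(1) by (intro shift_filter_finite) auto
    also have "\<dots> = (\<Sum>l=1..t + M - k. fps_nth (B_fps b) l * u (int t - int k - int l))"
      by (simp add: sum.atLeast_Suc_atMost B_fps_def)
    also have "\<dots> = (\<Sum>l=1..t + M - k. b l * u (int t - int k - int l))"
      by (intro sum.cong) (auto simp: B_fps_def)
    finally show ?thesis .
  qed
  have "pred_error u y b c (int t) =
      (\<Sum>k=0..t + M. h k * (y (int t - int k) - shift_filter (B_fps b) u (int t - int k)))"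
    unfolding pred_error_def h_def
    by (rule shift_filter_finite) (use assms(1) early in auto)
  also have "\<dots> = (\<Sum>k=0..t + M. h k * y (int t - int k) -
      (\<Sum>l=1..t + M - k. h k * b l * u (int t - int k - int l)))"
    by (intro sum.cong) (auto simp: late right_diff_distrib sum_distrib_left mult.assoc)
  finally show ?thesis by (simp add: sum_subtractf)
qed

end

theory Submission
  imports Defs
begin

text \<open>
  The average squared error depends on \<open>b\<close> and \<open>c\<close> only through their first \<open>N + M\<close> entries, and
  does so continuously: by the recursion for the coefficients of \<open>1 / C\<close>, these are polynomials in
  the entries of \<open>c\<close> (\<open>avg_sq_error_tendsto\<close>).  Along a minimizing sequence the two penalties are
  bounded, hence so are the norms and, by the reproducing property and the Cauchy--Schwarz
  inequality, every entry.  A subsequence therefore exists along which the first \<open>N + M\<close> entries of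
  \<open>b\<close> and \<open>c\<close> and both squared norms converge.

  It remains to find elements of the two Hilbert spaces that have the limiting entries and whose
  squared norms do not exceed the limits.  Lemma \<open>rkhs.ex_mem_of_tendsto_on\<close> provides
  them without weak compactness: among the functions that take the prescribed values up to the error
  \<open>1 / (n + 1)\<close>, choose one whose norm is nearly minimal.  These sets are convex and decreasing in
  \<open>n\<close>, so the parallelogram identity makes the chosen functions a Cauchy sequence, and its limit is
  as required.  The objective at the pair so obtained is at most the infimum.
\<close>

section \<open>Hilbert space estimates in a reproducing kernel Hilbert space\<close>

lemma (in rkhs) diff_mem:
  assumes "f \<in> H" "g \<in> H"
  shows "(\<lambda>x. f x - g x) \<in> H"
  using add_mem[OF assms(1) scale_mem[OF assms(2), of "-1"]] by simp

lemma (in rkhs) ip_diff_left: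
  assumes "f \<in> H" "g \<in> H" "h \<in> H"
  shows "ip (\<lambda>x. f x - g x) h = ip f h - ip g h"
  using ip_add_left[OF assms(1) scale_mem[OF assms(2), of "-1"] assms(3)]
    ip_scale_left[OF assms(2,3), of "-1"] by simp

lemma (in rkhs) ip_add_self:
  assumes "f \<in> H" "g \<in> H"
  shows "ip (\<lambda>x. f x + g x) (\<lambda>x. f x + g x) = ip f f + 2 * ip f g + ip g g"
proof -
  have s: "(\<lambda>x. f x + g x) \<in> H" using assms by (rule add_mem)
  have "ip f (\<lambda>x. f x + g x) = ip f f + ip f g"
    using ip_commute[OF assms(1) s] ip_add_left[OF assms assms(1)] ip_commute[OF assms] by simp
  moreover have "ip g (\<lambda>x. f x + g x) = ip f g + ip g g"
    using ip_commute[OF assms(2) s] ip_add_left[OF assms assms(2)] by simp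
  ultimately show ?thesis using ip_add_left[OF assms s] by simp
qed

lemma (in rkhs) ip_scale_self:
  assumes "f \<in> H"
  shows "ip (\<lambda>x. r * f x) (\<lambda>x. r * f x) = r\<^sup>2 * ip f f"
  using ip_scale_left[OF assms scale_mem[OF assms], of r r] ip_scale_left[OF assms assms, of r]
    ip_commute[OF assms scale_mem[OF assms], of r]
  by (simp add: power2_eq_square)

lemma (in rkhs) ip_diff_self:
  assumes "f \<in> H" "g \<in> H"
  shows "ip (\<lambda>x. f x - g x) (\<lambda>x. f x - g x) = ip f f - 2 * ip f g + ip g g"
proof -
  have g: "(\<lambda>x. -1 * g x) \<in> H" using assms(2) by (rule scale_mem)
  have "ip f (\<lambda>x. -1 * g x) = - ip f g"
    using ip_commute[OF assms(1) g] ip_scale_left[OF assms(2,1), of "-1"] ip_commute[OF assms]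
    by simp
  then show ?thesis
    using ip_add_self[OF assms(1) g] ip_scale_self[OF assms(2), of "-1"] by simp
qed

lemma (in rkhs) Cauchy_Schwarz:
  assumes f: "f \<in> H" and g: "g \<in> H"
  shows "(ip f g)\<^sup>2 \<le> ip f f * ip g g"
proof (cases "ip g g = 0")
  case True
  then have "g = (\<lambda>x. 0 * f x)" using ip_definite[OF g] by simp
  then have "ip f g = 0"
    using ip_scale_left[OF f f, of 0] ip_commute[OF f g] by simp
  then show ?thesis using True by simp
next
  case False
  then have pos: "ip g g > 0" using ip_nonneg[OF g] by simp
  define t where "t = ip f g / ip g g"
  have tg: "(\<lambda>x. t * g x) \<in> H" using g by (rule scale_mem)
  have "0 \<le> ip f f - 2 * ip f (\<lambda>x. t * g x) + ip (\<lambda>x. t * g x) (\<lambda>x. t * g x)"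
    using ip_nonneg[OF diff_mem[OF f tg]] ip_diff_self[OF f tg] by simp
  also have "ip f (\<lambda>x. t * g x) = t * ip f g"
    using ip_commute[OF f tg] ip_scale_left[OF g f] ip_commute[OF f g] by simp
  also have "ip (\<lambda>x. t * g x) (\<lambda>x. t * g x) = t\<^sup>2 * ip g g"
    using g by (rule ip_scale_self)
  finally show ?thesis
    using pos by (simp add: t_def field_simps power2_eq_square)
qed

lemma (in rkhs) evaluation_bound:
  assumes "f \<in> H" "a \<in> X"
  shows "(f a)\<^sup>2 \<le> ip f f * K a a"
proof -
  have "ip (kernel_section X K a) (kernel_section X K a) = K a a"
    using reproducing[OF kernel_section_mem[OF assms(2)] assms(2)] assms(2)
    by (simp add: kernel_section_def)
  then show ?thesis
    using Cauchy_Schwarz[OF assms(1) kernel_section_mem[OF assms(2)]] reproducing[OF assms] by simp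
qed

text \<open>Convergence in norm implies weak convergence.\<close>

lemma (in rkhs) ip_tendsto:
  assumes F: "\<And>n. F n \<in> H" and f: "f \<in> H" and g: "g \<in> H"
    and lim: "(\<lambda>n. ip (\<lambda>x. F n x - f x) (\<lambda>x. F n x - f x)) \<longlonglongrightarrow> 0"
  shows "(\<lambda>n. ip (F n) g) \<longlonglongrightarrow> ip f g"
proof -
  have "(\<lambda>n. (ip (F n) g - ip f g)\<^sup>2) \<longlonglongrightarrow> 0"
  proof (rule tendsto_sandwich[OF always_eventually always_eventually tendsto_const])
    show "\<forall>n. 0 \<le> (ip (F n) g - ip f g)\<^sup>2" by simp
    show "\<forall>n. (ip (F n) g - ip f g)\<^sup>2 \<le> ip (\<lambda>x. F n x - f x) (\<lambda>x. F n x - f x) * ip g g"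
      using Cauchy_Schwarz[OF diff_mem[OF F f] g] ip_diff_left[OF F f g] by simp
    show "(\<lambda>n. ip (\<lambda>x. F n x - f x) (\<lambda>x. F n x - f x) * ip g g) \<longlonglongrightarrow> 0"
      using tendsto_mult[OF lim tendsto_const[of "ip g g"]] by simp
  qed
  then have "(\<lambda>n. ip (F n) g - ip f g) \<longlonglongrightarrow> 0"
    by (simp add: power_tendsto_0_iff)
  then show ?thesis by (simp add: LIM_zero_iff)
qed

lemma (in rkhs) ip_self_tendsto:
  assumes F: "\<And>n. F n \<in> H" and f: "f \<in> H"
    and lim: "(\<lambda>n. ip (\<lambda>x. F n x - f x) (\<lambda>x. F n x - f x)) \<longlonglongrightarrow> 0"
  shows "(\<lambda>n. ip (F n) (F n)) \<longlonglongrightarrow> ip f f"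
proof -
  have "(\<lambda>n. ip (\<lambda>x. F n x - f x) (\<lambda>x. F n x - f x) + 2 * ip (F n) f - ip f f) \<longlonglongrightarrow>
      0 + 2 * ip f f - ip f f"
    by (intro tendsto_intros lim ip_tendsto[OF F f f lim])
  then show ?thesis using ip_diff_self[OF F f] by simp
qed

section \<open>Interpolating the limit values without increasing the norm\<close>

text \<open>
  The set of pairs consisting of the restriction of some \<open>f \<in> H\<close> to a finite set \<open>A\<close> and a bound
  on the squared norm of \<open>f\<close> is closed.
\<close>

lemma (in rkhs) ex_mem_of_tendsto_on:
  assumes A: "finite A" "A \<subseteq> X"
    and F: "\<And>n. F n \<in> H"
    and lim: "\<And>a. a \<in> A \<Longrightarrow> (\<lambda>n. F n a) \<longlonglongrightarrow> v a"
    and lim_ip: "(\<lambda>n. ip (F n) (F n)) \<longlonglongrightarrow> s"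
  shows "\<exists>f\<in>H. (\<forall>a\<in>A. f a = v a) \<and> ip f f \<le> s"
proof -
  define D where "D n = {f \<in> H. \<forall>a\<in>A. \<bar>f a - v a\<bar> \<le> inverse (real (Suc n))}" for n
  define d where "d n = (INF f\<in>D n. ip f f)" for n
  have D_mono: "D m \<subseteq> D n" if "n \<le> m" for m n
  proof -
    have "inverse (real (Suc m)) \<le> inverse (real (Suc n))" using that by simp
    then show ?thesis unfolding D_def by (auto intro: order_trans)
  qed
  have ev: "eventually (\<lambda>m. F m \<in> D n) sequentially" for n
  proof -
    have "eventually (\<lambda>m. \<forall>a\<in>A. dist (F m a) (v a) < inverse (real (Suc n))) sequentially"
      using A(1) lim by (intro eventually_ball_finite ballI) (auto intro!: tendstoD)
    then show ?thesis
      by eventually_elim (auto simp: D_def F dist_real_def intro: less_imp_le)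
  qed
  have D_ne: "D n \<noteq> {}" for n
    using eventually_happens'[OF _ ev[of n]] by auto
  have bdd: "bdd_below ((\<lambda>f. ip f f) ` D n)" for n
    by (rule bdd_belowI[of _ 0]) (auto simp: D_def ip_nonneg)
  have d_le: "d n \<le> ip f f" if "f \<in> D n" for f n
    unfolding d_def using bdd that by (rule cINF_lower)
  have d_le_s: "d n \<le> s" for n
    by (rule tendsto_lowerbound[OF lim_ip eventually_mono[OF ev[of n] d_le]]) simp_all
  have "incseq d"
    unfolding d_def by (intro incseq_SucI cINF_superset_mono D_ne bdd D_mono) auto
  then obtain L where L: "d \<longlonglongrightarrow> L" and d_le_L: "\<And>n. d n \<le> L"
    using incseq_convergent[of d s] d_le_s by blast
  have L_le_s: "L \<le> s" using L d_le_s by (intro LIMSEQ_le_const2) auto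
  have "\<exists>p\<in>D n. ip p p < d n + inverse (real (Suc n))" for n
    using cInf_lessD[of "(\<lambda>f. ip f f) ` D n" "d n + inverse (real (Suc n))"] D_ne[of n]
    by (auto simp: d_def)
  then obtain p where pD: "\<And>n. p n \<in> D n"
    and p_lt: "\<And>n. ip (p n) (p n) < d n + inverse (real (Suc n))" by metis
  have pH: "p n \<in> H" for n using pD[of n] by (simp add: D_def)
  \<comment> \<open>The midpoint of \<open>p m\<close> and \<open>p n\<close> lies in the convex set \<open>D k\<close>, so its squared norm is at least
    \<open>d k\<close>; the parallelogram identity then bounds the distance.\<close>
  have close: "ip (\<lambda>x. p m x - p n x) (\<lambda>x. p m x - p n x) \<le> 4 * (L - d k + inverse (real (Suc k)))"
    if "k \<le> m" "k \<le> n" for k m n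
  proof -
    let ?q = "\<lambda>x. (1/2) * (p m x + p n x)"
    have in_D: "p m \<in> D k" "p n \<in> D k" using pD D_mono that by blast+
    have "?q \<in> D k"
    proof -
      have "\<bar>?q a - v a\<bar> \<le> inverse (real (Suc k))" if "a \<in> A" for a
      proof -
        have "\<bar>p m a - v a\<bar> \<le> inverse (real (Suc k))" "\<bar>p n a - v a\<bar> \<le> inverse (real (Suc k))"
          using in_D that by (auto simp: D_def)
        moreover have "\<bar>?q a - v a\<bar> \<le> (1/2) * (\<bar>p m a - v a\<bar> + \<bar>p n a - v a\<bar>)"
          by (simp add: abs_if field_simps)
        ultimately show ?thesis by simp
      qed
      moreover have "?q \<in> H" using pH by (intro scale_mem add_mem)
      ultimately show ?thesis by (simp add: D_def)
    qed
    then have "4 * d k \<le> 4 * ip ?q ?q" using d_le by simp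
    also have "\<dots> = ip (p m) (p m) + 2 * ip (p m) (p n) + ip (p n) (p n)"
      using ip_scale_self[OF add_mem[OF pH pH], of "1/2" m n] ip_add_self[OF pH pH, of m n]
      by (simp add: power2_eq_square)
    finally have "2 * ip (p m) (p n) \<ge> 4 * d k - ip (p m) (p m) - ip (p n) (p n)" by simp
    moreover have "ip (p i) (p i) \<le> L + inverse (real (Suc k))" if "k \<le> i" for i
    proof -
      have "inverse (real (Suc i)) \<le> inverse (real (Suc k))" using that by simp
      then show ?thesis using p_lt[of i] d_le_L[of i] by linarith
    qed
    ultimately show ?thesis
      using ip_diff_self[OF pH pH, of m n] that by (smt (verit))
  qed
  have bound_tendsto: "(\<lambda>k. 4 * (L - d k + inverse (real (Suc k)))) \<longlonglongrightarrow> 4 * (L - L + 0)"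
    by (intro tendsto_intros L LIMSEQ_inverse_real_of_nat)
  have "\<exists>n0. \<forall>m\<ge>n0. \<forall>n\<ge>n0. ip_norm ip (\<lambda>x. p m x - p n x) < e" if "e > 0" for e
  proof -
    have "eventually (\<lambda>k. 4 * (L - d k + inverse (real (Suc k))) < e\<^sup>2) sequentially"
      by (rule order_tendstoD(2)[OF bound_tendsto]) (use that in simp)
    then obtain k where k: "4 * (L - d k + inverse (real (Suc k))) < e\<^sup>2"
      by (auto simp: eventually_sequentially)
    have "ip_norm ip (\<lambda>x. p m x - p n x) < e" if mn: "k \<le> m" "k \<le> n" for m n
    proof -
      have "ip (\<lambda>x. p m x - p n x) (\<lambda>x. p m x - p n x) < e\<^sup>2"
        using close[OF mn] k by linarith
      then show ?thesis using \<open>e > 0\<close> by (simp add: ip_norm_def real_less_lsqrt)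
    qed
    then show ?thesis by blast
  qed
  then obtain f where f: "f \<in> H" and "(\<lambda>n. ip_norm ip (\<lambda>x. p n x - f x)) \<longlonglongrightarrow> 0"
    using complete[of p] pH by blast
  then have "(\<lambda>n. (ip_norm ip (\<lambda>x. p n x - f x))\<^sup>2) \<longlonglongrightarrow> 0"
    using tendsto_power[of _ 0 _ 2] by fastforce
  then have p_lim: "(\<lambda>n. ip (\<lambda>x. p n x - f x) (\<lambda>x. p n x - f x)) \<longlonglongrightarrow> 0"
    using ip_nonneg[OF diff_mem[OF pH f]] by (simp add: ip_norm_def)
  have "f a = v a" if a: "a \<in> A" for a
  proof -
    have "(\<lambda>n. p n a) \<longlonglongrightarrow> f a"
      using ip_tendsto[OF pH f kernel_section_mem p_lim, of a] reproducing[OF pH] reproducing[OF f]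
        a A(2) by auto
    moreover have "(\<lambda>n. p n a - v a) \<longlonglongrightarrow> 0"
    proof (rule Lim_null_comparison[OF always_eventually LIMSEQ_inverse_real_of_nat])
      show "\<forall>n. norm (p n a - v a) \<le> inverse (real (Suc n))"
        using pD a by (simp add: D_def)
    qed
    ultimately show ?thesis by (rule LIMSEQ_unique[OF _ LIM_zero_cancel])
  qed
  moreover have "ip f f \<le> s"
  proof -
    have "(\<lambda>n. d n + inverse (real (Suc n))) \<longlonglongrightarrow> L + 0"
      by (intro tendsto_intros L LIMSEQ_inverse_real_of_nat)
    then have "ip f f \<le> L + 0"
      using p_lt by (intro LIMSEQ_le[OF ip_self_tendsto[OF pH f p_lim]]) (auto intro: less_imp_le)
    then show ?thesis using L_le_s by simp
  qed
  ultimately show ?thesis using f by blast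
qed

section \<open>Continuity of the average squared prediction error\<close>

text \<open>
  Only the entries up to the index considered are required to converge, and entry \<open>0\<close> plays no role.
\<close>

lemma inverse_C_fps_nth_tendsto:
  assumes lim: "\<And>i. i \<in> {1..n} \<Longrightarrow> (\<lambda>j. cs j i) \<longlonglongrightarrow> c i"
    and "k \<le> n"
  shows "(\<lambda>j. fps_nth (inverse (C_fps (cs j))) k) \<longlonglongrightarrow> fps_nth (inverse (C_fps c)) k"
  using \<open>k \<le> n\<close>
proof (induction k rule: less_induct)
  case (less k)
  show ?case
  proof (cases "k = 0")
    case True
    then show ?thesis by (simp add: C_fps_def)
  next
    case False
    then have k: "k \<ge> 1" by simp
    show ?thesis
      unfolding inverse_C_fps_nth(2)[OF k]
      by (intro tendsto_intros lim less.IH) (use k less.prems in auto)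
  qed
qed

lemma avg_sq_error_tendsto:
  fixes M N :: nat
  assumes zero: "\<And>s. s < - int M \<Longrightarrow> y s = 0 \<and> u s = 0"
    and b: "\<And>k. k \<in> {1..N + M} \<Longrightarrow> (\<lambda>j. bs j k) \<longlonglongrightarrow> b k"
    and c: "\<And>k. k \<in> {1..N + M} \<Longrightarrow> (\<lambda>j. cs j k) \<longlonglongrightarrow> c k"
  shows "(\<lambda>j. avg_sq_error N u y (bs j) (cs j)) \<longlonglongrightarrow> avg_sq_error N u y b c"
proof -
  have h: "(\<lambda>j. fps_nth (inverse (C_fps (cs j))) k) \<longlonglongrightarrow> fps_nth (inverse (C_fps c)) k"
    if "k \<le> N + M" for k
    using c that by (rule inverse_C_fps_nth_tendsto)
  have "(\<lambda>j. pred_error u y (bs j) (cs j) (int t)) \<longlonglongrightarrow> pred_error u y b c (int t)"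
    if "t \<in> {1..N}" for t
    by (simp only: pred_error_explicit[where M = M and y = y and u = u, OF zero])
      (intro tendsto_intros h b; use that in auto)
  then show ?thesis
    unfolding avg_sq_error_def by (intro tendsto_intros)
qed

section \<open>Existence of a minimizer\<close>

lemma common_convergent_subsequence:
  fixes f :: "'i \<Rightarrow> nat \<Rightarrow> real"
  assumes "finite I" and "\<And>i. i \<in> I \<Longrightarrow> bounded (range (f i))"
  shows "\<exists>r. strict_mono r \<and> (\<forall>i\<in>I. convergent (\<lambda>n. f i (r n)))"
  using assms
proof (induction I rule: finite_induct)
  case empty
  then show ?case using strict_mono_id by blast
next
  case (insert i I)
  then obtain r where r: "strict_mono r" "\<And>k. k \<in> I \<Longrightarrow> convergent (\<lambda>n. f k (r n))"
    by auto
  have "bounded (range (f i \<circ> r))"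
    using insert.prems[of i] by (rule bounded_subset) auto
  then obtain l q where q: "strict_mono q" "((f i \<circ> r) \<circ> q) \<longlonglongrightarrow> l"
    using bounded_imp_convergent_subsequence by blast
  have "convergent (\<lambda>n. f k (r (q n)))" if "k \<in> insert i I" for k
  proof (cases "k = i")
    case True
    then show ?thesis using q(2) by (auto simp: convergent_def o_def)
  next
    case False
    then show ?thesis
      using that r(2)[of k] convergent_subseq_convergent[OF _ q(1), of "\<lambda>n. f k (r n)"]
      by (auto simp: o_def)
  qed
  then show ?case
    using strict_mono_o[OF r(1) q(1)] by (intro exI[of _ "r \<circ> q"]) (simp add: o_def)
qed

lemma (in rkhs) bounded_evaluation:
  assumes "\<And>n. F n \<in> H" "\<And>n. ip (F n) (F n) \<le> R" "a \<in> X"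
  shows "bounded (range (\<lambda>n. F n a))"
proof -
  have "0 \<le> K a a" using kernel_psd[of "{a}" "\<lambda>_. 1"] assms(3) by simp
  then have "(F n a)\<^sup>2 \<le> R * K a a" for n
    using evaluation_bound[OF assms(1,3)] mult_right_mono[OF assms(2)] by (meson order_trans)
  then have "\<bar>F n a\<bar> \<le> sqrt (R * K a a)" for n
    by (simp add: real_le_rsqrt)
  then show ?thesis by (auto simp: bounded_iff)
qed

lemma (in rkhs) bounded_ip_self:
  assumes "\<And>n. F n \<in> H" "\<And>n. ip (F n) (F n) \<le> R"
  shows "bounded (range (\<lambda>n. ip (F n) (F n)))"
  using assms ip_nonneg by (auto simp: bounded_iff intro!: exI[of _ R])

lemma (in rkhs) ip_norm_power2: "f \<in> H \<Longrightarrow> (ip_norm ip f)\<^sup>2 = ip f f"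
  by (simp add: ip_norm_def ip_nonneg)

theorem theorem9:
  fixes N :: nat
    and u y :: "int \<Rightarrow> real"
    and \<sigma> lam\<^sub>b lam\<^sub>c \<gamma>\<^sub>b \<gamma>\<^sub>c :: real
    and K\<^sub>b K\<^sub>c :: "nat \<Rightarrow> nat \<Rightarrow> real"
    and H\<^sub>b H\<^sub>c :: "(nat \<Rightarrow> real) set"
    and ip\<^sub>b ip\<^sub>c :: "(nat \<Rightarrow> real) \<Rightarrow> (nat \<Rightarrow> real) \<Rightarrow> real"
  assumes "N \<ge> 1"
    and "\<sigma>\<^sup>2 > 0" "lam\<^sub>b > 0" "lam\<^sub>c > 0"
    and "\<gamma>\<^sub>b = \<sigma>\<^sup>2 / (real N * lam\<^sub>b)" "\<gamma>\<^sub>c = \<sigma>\<^sup>2 / (real N * lam\<^sub>c)"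
    and "rkhs {1..} K\<^sub>b H\<^sub>b ip\<^sub>b" "rkhs {1..} K\<^sub>c H\<^sub>c ip\<^sub>c"
    and "H\<^sub>b \<subseteq> ell2" "H\<^sub>c \<subseteq> ell2"
    and "H\<^sub>b \<subseteq> ell1" "H\<^sub>c \<subseteq> ell1"
    and "\<exists>M::nat. \<forall>s < - int M. y s = 0 \<and> u s = 0"
  shows "\<exists>\<theta>. is_arg_min
    (\<lambda>(b, c). avg_sq_error N u y b c + \<gamma>\<^sub>b * (ip_norm ip\<^sub>b b)\<^sup>2 + \<gamma>\<^sub>c * (ip_norm ip\<^sub>c c)\<^sup>2)
    (\<lambda>\<theta>. \<theta> \<in> H\<^sub>b \<times> H\<^sub>c) \<theta>"
proof -
  interpret b: rkhs "{1..}" K\<^sub>b H\<^sub>b ip\<^sub>b by fact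
  interpret c: rkhs "{1..}" K\<^sub>c H\<^sub>c ip\<^sub>c by fact
  from assms(13) obtain M :: nat where zero: "\<And>s. s < - int M \<Longrightarrow> y s = 0 \<and> u s = 0" by blast
  have \<gamma>: "\<gamma>\<^sub>b > 0" "\<gamma>\<^sub>c > 0" using assms(1-6) by simp_all
  define A where "A = {1..N + M}"
  have A: "finite A" "A \<subseteq> {1..}" by (auto simp: A_def)
  define V where "V = avg_sq_error N u y"
  define J where "J b c = V b c + \<gamma>\<^sub>b * ip\<^sub>b b b + \<gamma>\<^sub>c * ip\<^sub>c c c" for b c
  define m where "m = (INF \<theta>\<in>H\<^sub>b \<times> H\<^sub>c. J (fst \<theta>) (snd \<theta>))"
  have V_nonneg: "0 \<le> V b c" for b c
    by (simp add: V_def avg_sq_error_def sum_nonneg)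
  have bdd: "bdd_below ((\<lambda>\<theta>. J (fst \<theta>) (snd \<theta>)) ` (H\<^sub>b \<times> H\<^sub>c))"
    using \<gamma> V_nonneg by (intro bdd_belowI[of _ 0]) (auto simp: J_def b.ip_nonneg c.ip_nonneg)
  have m_le: "m \<le> J b c" if "b \<in> H\<^sub>b" "c \<in> H\<^sub>c" for b c
    using cINF_lower[OF bdd, of "(b, c)"] that by (simp add: m_def)
  have "\<exists>\<theta>\<in>H\<^sub>b \<times> H\<^sub>c. J (fst \<theta>) (snd \<theta>) < m + inverse (real (Suc n))" for n
    using cInf_lessD[of "(\<lambda>\<theta>. J (fst \<theta>) (snd \<theta>)) ` (H\<^sub>b \<times> H\<^sub>c)" "m + inverse (real (Suc n))"]
      b.zero_mem c.zero_mem by (auto simp: m_def)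
  then obtain \<theta> where \<theta>: "\<And>n. \<theta> n \<in> H\<^sub>b \<times> H\<^sub>c"
    "\<And>n. J (fst (\<theta> n)) (snd (\<theta> n)) < m + inverse (real (Suc n))" by metis
  define bs cs where "bs = fst \<circ> \<theta>" and "cs = snd \<circ> \<theta>"
  have bs: "bs n \<in> H\<^sub>b" and cs: "cs n \<in> H\<^sub>c"
    and J_lt: "J (bs n) (cs n) < m + inverse (real (Suc n))" for n
    using \<theta>(1)[of n] \<theta>(2)[of n] by (auto simp: bs_def cs_def mem_Times_iff)
  have J_le: "J (bs n) (cs n) \<le> m + 1" for n
  proof -
    have "inverse (real (Suc n)) \<le> 1" by (simp add: field_simps)
    then show ?thesis using J_lt[of n] by linarith
  qed
  have b_le: "ip\<^sub>b (bs n) (bs n) \<le> (m + 1) / \<gamma>\<^sub>b" for n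
  proof -
    have "\<gamma>\<^sub>b * ip\<^sub>b (bs n) (bs n) \<le> m + 1"
      using J_le[of n] V_nonneg[of "bs n" "cs n"]
        mult_nonneg_nonneg[OF less_imp_le[OF \<gamma>(2)] c.ip_nonneg[OF cs, of n]]
      unfolding J_def by linarith
    then show ?thesis using \<gamma>(1) by (simp add: field_simps)
  qed
  have c_le: "ip\<^sub>c (cs n) (cs n) \<le> (m + 1) / \<gamma>\<^sub>c" for n
  proof -
    have "\<gamma>\<^sub>c * ip\<^sub>c (cs n) (cs n) \<le> m + 1"
      using J_le[of n] V_nonneg[of "bs n" "cs n"]
        mult_nonneg_nonneg[OF less_imp_le[OF \<gamma>(1)] b.ip_nonneg[OF bs, of n]]
      unfolding J_def by linarith
    then show ?thesis using \<gamma>(2) by (simp add: field_simps)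
  qed
  \<comment> \<open>Entry \<open>0\<close> carries no information, so its slot holds the sequence of squared norms; every
    other \<open>k\<close> stands for the sequence of \<open>k\<close>-th entries.\<close>
  define G where "G = (\<lambda>(is_b, k) n. if is_b
    then (if k = 0 then ip\<^sub>b (bs n) (bs n) else bs n k)
    else (if k = 0 then ip\<^sub>c (cs n) (cs n) else cs n k))"
  have "bounded (range (G i))" for i
    using b.bounded_ip_self[of bs, OF bs b_le] b.bounded_evaluation[of bs, OF bs b_le]
      c.bounded_ip_self[of cs, OF cs c_le] c.bounded_evaluation[of cs, OF cs c_le]
    by (cases i) (auto simp: G_def)
  then obtain r where r: "strict_mono r"
    and conv: "\<forall>i\<in>UNIV \<times> insert 0 A. convergent (\<lambda>n. G i (r n))"
    using common_convergent_subsequence[of "UNIV \<times> insert 0 A" G] A(1)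
      finite_cartesian_product[OF finite[of UNIV], of "insert 0 A"] by blast
  have G_lim: "(\<lambda>n. G i (r n)) \<longlonglongrightarrow> lim (\<lambda>n. G i (r n))" if "i \<in> UNIV \<times> insert 0 A" for i
    using bspec[OF conv that] by (simp add: convergent_LIMSEQ_iff)
  obtain s where b_ip: "(\<lambda>n. ip\<^sub>b (bs (r n)) (bs (r n))) \<longlonglongrightarrow> s"
    using G_lim[of "(True, 0)"] by (auto simp: G_def)
  obtain t where c_ip: "(\<lambda>n. ip\<^sub>c (cs (r n)) (cs (r n))) \<longlonglongrightarrow> t"
    using G_lim[of "(False, 0)"] by (auto simp: G_def)
  have b_lim: "(\<lambda>n. bs (r n) k) \<longlonglongrightarrow> lim (\<lambda>n. G (True, k) (r n))"
    and c_lim: "(\<lambda>n. cs (r n) k) \<longlonglongrightarrow> lim (\<lambda>n. G (False, k) (r n))" if "k \<in> A" for k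
    using G_lim[of "(True, k)"] G_lim[of "(False, k)"] that by (auto simp: G_def A_def)
  obtain b where b: "b \<in> H\<^sub>b" "\<And>k. k \<in> A \<Longrightarrow> b k = lim (\<lambda>n. G (True, k) (r n))" "ip\<^sub>b b b \<le> s"
    using b.ex_mem_of_tendsto_on[OF A bs b_lim b_ip] by blast
  obtain c where c: "c \<in> H\<^sub>c" "\<And>k. k \<in> A \<Longrightarrow> c k = lim (\<lambda>n. G (False, k) (r n))" "ip\<^sub>c c c \<le> t"
    using c.ex_mem_of_tendsto_on[OF A cs c_lim c_ip] by blast
  have "(\<lambda>n. V (bs (r n)) (cs (r n))) \<longlonglongrightarrow> V b c"
    unfolding V_def using b_lim b(2) c_lim c(2)
    by (intro avg_sq_error_tendsto[OF zero]) (auto simp: A_def)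
  then have "(\<lambda>n. J (bs (r n)) (cs (r n))) \<longlonglongrightarrow> V b c + \<gamma>\<^sub>b * s + \<gamma>\<^sub>c * t"
    unfolding J_def by (intro tendsto_intros b_ip c_ip)
  moreover have "(\<lambda>n. m + inverse (real (Suc (r n)))) \<longlonglongrightarrow> m + 0"
    using LIMSEQ_subseq_LIMSEQ[OF LIMSEQ_inverse_real_of_nat r]
    by (intro tendsto_intros) (simp add: o_def)
  ultimately have "V b c + \<gamma>\<^sub>b * s + \<gamma>\<^sub>c * t \<le> m + 0"
    using J_lt by (intro LIMSEQ_le) (auto intro: less_imp_le)
  moreover have "J b c \<le> V b c + \<gamma>\<^sub>b * s + \<gamma>\<^sub>c * t"
    using b(3) c(3) \<gamma> by (simp add: J_def add_mono)
  ultimately have "J b c \<le> J b' c'" if "b' \<in> H\<^sub>b" "c' \<in> H\<^sub>c" for b' c'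
    using m_le[OF that] by linarith
  then have "is_arg_min
    (\<lambda>(b, c). avg_sq_error N u y b c + \<gamma>\<^sub>b * (ip_norm ip\<^sub>b b)\<^sup>2 + \<gamma>\<^sub>c * (ip_norm ip\<^sub>c c)\<^sup>2)
    (\<lambda>\<theta>. \<theta> \<in> H\<^sub>b \<times> H\<^sub>c) (b, c)"
    using b(1) c(1)
    by (auto simp: is_arg_min_def J_def V_def b.ip_norm_power2 c.ip_norm_power2 not_less)
  then show ?thesis ..
qed

end
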